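(* Let $A$ be a normal domain (that is, integrally closed in its quotient field $K$) and let $L$ be an algebraic field extension of $K$. Let $I_L(A)$ be the integral closure of $A$ in $L$. If $I_L(A)$ is a finitely generated $A$-algebra, then it is a finite $A$-module.
   Context: A finite $A$-module is a finitely generated $A$-module. *)

theory Defs
  imports "HOL-Algebra.Finite_Extensions" "HOL-Algebra.Generated_Rings"
begin

text \<open>
  Following the convention of \<^theory>\<open>HOL-Algebra.Finite_Extensions\<close>, rings and fields are
  subsets of the carrier of one ambient ring, and the canonical injections
  \<open>A \<rightarrow> K \<rightarrow> L\<close> are inclusions.
\<close>

context ring
begin

text \<open>\<open>p \<noteq> []\<close> excludes the zero polynomial, on which \<open>lead_coeff = hd\<close> is unspecified.\<close>

definition integral :: "'a set \<Rightarrow> 'a \<Rightarrow> bool"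
  where "integral A x \<longleftrightarrow>
    (\<exists>p \<in> carrier (A[X]). p \<noteq> [] \<and> lead_coeff p = \<one> \<and> eval p x = \<zero>)"

definition integral_closure :: "'a set \<Rightarrow> 'a set \<Rightarrow> 'a set"
  where "integral_closure A B = {x \<in> B. (integral over A) x}"

definition is_quotient_field :: "'a set \<Rightarrow> 'a set \<Rightarrow> bool"
  where "is_quotient_field K A \<longleftrightarrow>
    subfield K R \<and> A \<subseteq> K \<and> (\<forall>k \<in> K. \<exists>a \<in> A. \<exists>b \<in> A - {\<zero>}. k = a \<otimes> inv b)"

text \<open>The \<open>A\<close>-subalgebra generated by \<open>S\<close> is the subring generated by \<open>A \<union> S\<close>.\<close>

definition finitely_generated_algebra :: "'a set \<Rightarrow> 'a set \<Rightarrow> bool"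
  where "finitely_generated_algebra A B \<longleftrightarrow>
    (\<exists>S. finite S \<and> S \<subseteq> B \<and> generate_ring R (A \<union> S) = B)"

text \<open>Nothing in the definition of \<open>Span\<close> requires its first argument to be a field:
  \<open>Span A us\<close> is the set of all \<open>A\<close>-linear combinations of \<open>us\<close>.\<close>

definition finite_module :: "'a set \<Rightarrow> 'a set \<Rightarrow> bool"
  where "finite_module A M \<longleftrightarrow> (\<exists>us. set us \<subseteq> M \<and> Span A us = M)"

end

end

theory Submission
  imports Defs
begin

text \<open>
  If \<open>x\<close> is a root of a monic polynomial of degree \<open>n\<close> over a subring \<open>C\<close>, then \<open>C[x]\<close> is spanned
  over \<open>C\<close> by \<open>1, x, \<dots>, x\<^sup>n\<^sup>-\<^sup>1\<close>. Adjoining finitely many integral generators one at a time and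
  multiplying the spanning sets gives a finite spanning set over \<open>A\<close>.
\<close>

context ring
begin

section \<open>Linear combinations over a subring\<close>

lemma Span_Nil: "Span K [] = {\<zero>}"
  by simp

lemma Span_Cons: "Span K (u # us) = line_extension K u (Span K us)"
  by simp

text \<open>\<open>Span.simps\<close> would unfold every span into a fold. The recursive equations
  fire only on constructors, so \<open>Span K us\<close> survives in inductions.\<close>

declare Span.simps [simp del] Span_Nil [simp] Span_Cons [simp]

text \<open>Serves as the induction principle for spans: with a suitable \<open>M\<close>, a
  property of all linear combinations reduces to sums and single terms.\<close>

lemma Span_least:
  assumes "\<zero> \<in> M"
    and "\<And>x y. \<lbrakk> x \<in> M; y \<in> M \<rbrakk> \<Longrightarrow> x \<oplus> y \<in> M"
    and "\<And>k u. \<lbrakk> k \<in> K; u \<in> set us \<rbrakk> \<Longrightarrow> k \<otimes> u \<in> M"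
  shows "Span K us \<subseteq> M"
  using assms(3)
proof (induct us)
  case Nil
  then show ?case using assms(1) by simp
next
  case (Cons u us)
  then have "Span K us \<subseteq> M" and "\<And>k. k \<in> K \<Longrightarrow> k \<otimes> u \<in> M" by auto
  then show ?case
    using assms(2) by (fastforce simp: line_extension_mem_iff)
qed

text \<open>This and the next closure properties are stated for subrings, since neither
  \<open>A\<close> nor the rings obtained by adjoining generators need be fields.\<close>

lemma Span_zero_closed:
  assumes "subring K R" "set us \<subseteq> carrier R"
  shows "\<zero> \<in> Span K us"
  using assms(2)
proof (induct us)
  case (Cons u us)
  then have "\<zero> = \<zero> \<otimes> u \<oplus> \<zero>" by simp
  moreover have "\<zero> \<in> Span K us" using Cons by simp
  ultimately show ?case
    using subringE(2)[OF assms(1)] unfolding Span_Cons line_extension_mem_iff by blast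
qed simp

lemma Span_add_closed:
  assumes "subring K R" "set us \<subseteq> carrier R" "x \<in> Span K us" "y \<in> Span K us"
  shows "x \<oplus> y \<in> Span K us"
  using assms(2-)
proof (induct us arbitrary: x y)
  case (Cons u us)
  obtain k v where x: "k \<in> K" "v \<in> Span K us" "x = k \<otimes> u \<oplus> v"
    using Cons.prems(2) by (auto simp: line_extension_mem_iff)
  obtain l w where y: "l \<in> K" "w \<in> Span K us" "y = l \<otimes> u \<oplus> w"
    using Cons.prems(3) by (auto simp: line_extension_mem_iff)
  have "k \<in> carrier R" "l \<in> carrier R" "u \<in> carrier R" "v \<in> carrier R" "w \<in> carrier R"
    using x y Cons.prems(1) subringE(1)[OF assms(1)] Span_in_carrier[of K us] by auto
  then have "x \<oplus> y = (k \<oplus> l) \<otimes> u \<oplus> (v \<oplus> w)"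
    unfolding x(3) y(3) by algebra
  moreover have "v \<oplus> w \<in> Span K us"
    using Cons.hyps Cons.prems(1) x(2) y(2) by simp
  ultimately show ?case
    using x(1) y(1) subringE(7)[OF assms(1)] by (auto simp: line_extension_mem_iff)
qed simp

lemma Span_mult_closed:
  assumes "subring K R" "set us \<subseteq> carrier R" "k \<in> K" "x \<in> Span K us"
  shows "k \<otimes> x \<in> Span K us"
  using assms(2,4)
proof (induct us arbitrary: x)
  case Nil
  then show ?case using assms(1,3) subringE(1)[OF assms(1)] by auto
next
  case (Cons u us)
  obtain l v where x: "l \<in> K" "v \<in> Span K us" "x = l \<otimes> u \<oplus> v"
    using Cons.prems(2) by (auto simp: line_extension_mem_iff)
  have "k \<in> carrier R" "l \<in> carrier R" "u \<in> carrier R" "v \<in> carrier R"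
    using x assms(3) Cons.prems(1) subringE(1)[OF assms(1)] Span_in_carrier[of K us] by auto
  then have "k \<otimes> x = (k \<otimes> l) \<otimes> u \<oplus> k \<otimes> v"
    unfolding x(3) by algebra
  moreover have "k \<otimes> v \<in> Span K us"
    using Cons.hyps Cons.prems(1) x(2) by simp
  ultimately show ?case
    using x(1) assms(3) subringE(6)[OF assms(1)] by (auto simp: line_extension_mem_iff)
qed

lemma Span_superset:
  assumes "subring K R" "set us \<subseteq> carrier R"
  shows "set us \<subseteq> Span K us"
  using assms(2)
proof (induct us)
  case (Cons u us)
  have "u = \<one> \<otimes> u \<oplus> \<zero>" using Cons.prems by simp
  then have "u \<in> Span K (u # us)"
    using Span_zero_closed[OF assms(1), of us] Cons.prems subringE(3)[OF assms(1)]
    unfolding Span_Cons line_extension_mem_iff by (metis list.set_intros(2) subset_code(1))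
  moreover have "v \<in> Span K (u # us)" if "v \<in> set us" for v
  proof -
    have "v \<in> Span K us" "v \<in> carrier R" using that Cons by auto
    moreover have "v = \<zero> \<otimes> u \<oplus> v" using Cons.prems that by auto
    ultimately show ?thesis
      using subringE(2)[OF assms(1)] by (auto simp: line_extension_mem_iff)
  qed
  ultimately show ?case by auto
qed simp

text \<open>Transitivity of finite generation: expanding the coefficient of each \<open>v\<close> in
  terms of \<open>us\<close> turns a combination of \<open>vs\<close> into one of the
  products.\<close>

lemma Span_Span:
  assumes "subring K R" "set us \<subseteq> carrier R" "set vs \<subseteq> carrier R"
    and "subring (Span K us) R"
  shows "Span (Span K us) vs = Span K [u \<otimes> v. u \<leftarrow> us, v \<leftarrow> vs]" (is "?L = Span K ?ws")
proof
  have ws: "set ?ws \<subseteq> carrier R" using assms(2,3) by auto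
  note K = subringE(1)[OF assms(1)]
  show "?L \<subseteq> Span K ?ws"
  proof (rule Span_least)
    fix k v assume k: "k \<in> Span K us" and v: "v \<in> set vs"
    have vc: "v \<in> carrier R" using v assms(3) by auto
    \<comment> \<open>For fixed \<open>v\<close> the admissible coefficients are closed under sums,
      so it suffices to treat \<open>k \<otimes> u\<close>, where associativity exposes the product
      \<open>u \<otimes> v\<close>.\<close>
    have "Span K us \<subseteq> {c \<in> carrier R. c \<otimes> v \<in> Span K ?ws}"
    proof (rule Span_least)
      show "\<zero> \<in> {c \<in> carrier R. c \<otimes> v \<in> Span K ?ws}"
        using vc Span_zero_closed[OF assms(1) ws] by simp
    next
      fix x y assume "x \<in> {c \<in> carrier R. c \<otimes> v \<in> Span K ?ws}"
        "y \<in> {c \<in> carrier R. c \<otimes> v \<in> Span K ?ws}"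
      then show "x \<oplus> y \<in> {c \<in> carrier R. c \<otimes> v \<in> Span K ?ws}"
        using vc Span_add_closed[OF assms(1) ws] by (simp add: l_distr)
    next
      fix k u assume "k \<in> K" "u \<in> set us"
      moreover from this have "u \<otimes> v \<in> Span K ?ws"
        using v Span_superset[OF assms(1) ws] by (auto)
      ultimately show "k \<otimes> u \<in> {c \<in> carrier R. c \<otimes> v \<in> Span K ?ws}"
        using vc K assms(2) Span_mult_closed[OF assms(1) ws]
        by (auto simp add: m_assoc subset_iff)
    qed
    then show "k \<otimes> v \<in> Span K ?ws" using k by blast
  qed (use Span_zero_closed[OF assms(1) ws] Span_add_closed[OF assms(1) ws] in blast)+
  show "Span K ?ws \<subseteq> ?L"
  proof (rule Span_least)
    fix k w assume k: "k \<in> K" and "w \<in> set ?ws"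
    then obtain u v where uv: "u \<in> set us" "v \<in> set vs" "w = u \<otimes> v" by auto
    have "k \<otimes> u \<in> Span K us"
      using Span_mult_closed[OF assms(1,2) k] Span_superset[OF assms(1,2)] uv(1) by blast
    then have "k \<otimes> u \<otimes> v \<in> ?L"
      using Span_mult_closed[OF assms(4,3)] Span_superset[OF assms(4,3)] uv(2) by blast
    moreover have "k \<otimes> w = k \<otimes> u \<otimes> v"
      using k uv K assms(2,3) by (auto simp: m_assoc subset_iff)
    ultimately show "k \<otimes> w \<in> ?L" by simp
  qed (use Span_zero_closed[OF assms(4,3)] Span_add_closed[OF assms(4,3)] in blast)+
qed

section \<open>Adjoining one integral element\<close>

text \<open>Lists with entries in \<open>K\<close> replace polynomials here because the lemma is
  applied to the tail of a polynomial, which may start with zero.\<close>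

lemma eval_in_Span_exp_base:
  assumes "subring K R" "x \<in> carrier R" "set p \<subseteq> K" "length p \<le> n"
  shows "eval p x \<in> Span K (exp_base x n)"
  using assms(3,4)
proof (induct p)
  case Nil
  then show ?case
    using Span_zero_closed[OF assms(1) exp_base_closed[OF assms(2)]] by simp
next
  case (Cons a p)
  note B = exp_base_closed[OF assms(2), of n]
  \<comment> \<open>Coefficients are listed from the highest exponent down, so \<open>a\<close>
    belongs to exponent \<open>length p\<close>, which is below \<open>n\<close>.\<close>
  have "x [^] length p \<in> set (exp_base x n)"
    using Cons.prems(2) by (auto simp: exp_base_def)
  then have "a \<otimes> x [^] length p \<in> Span K (exp_base x n)"
    using Cons.prems(1) Span_superset[OF assms(1) B] Span_mult_closed[OF assms(1) B, of a]
    by (auto)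
  then show ?case
    using Cons Span_add_closed[OF assms(1) B] by (simp)
qed

text \<open>The bound \<open>length p\<close> admits one exponent beyond the spanning powers, namely
  \<open>degree p\<close>; the monic equation expresses that power by the lower ones.\<close>

lemma pow_in_Span_exp_base:
  assumes "subring K R" "x \<in> carrier R"
    and "set p \<subseteq> K" "p \<noteq> []" "lead_coeff p = \<one>" "eval p x = \<zero>"
    and "i < length p"
  shows "x [^] i \<in> Span K (exp_base x (degree p))"
proof (cases "i < degree p")
  case True
  then have "x [^] i \<in> set (exp_base x (degree p))"
    by (auto simp: exp_base_def)
  then show ?thesis
    using Span_superset[OF assms(1) exp_base_closed[OF assms(2)]] by blast
next
  case False
  then have i: "i = degree p" using assms(7) by simp
  have t: "set (tl p) \<subseteq> K" using assms(3,4) by (auto dest: list.set_sel(2))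
  then have tc: "eval (tl p) x \<in> carrier R"
    using subringE(1)[OF assms(1)] assms(2) by (intro eval_in_carrier) auto
  have "x [^] i \<oplus> eval (tl p) x = \<zero>"
    using assms(2,4-6) i by (cases p) auto
  then have "x [^] i = \<ominus> \<one> \<otimes> eval (tl p) x"
    using assms(2) tc by (simp add: l_minus minus_equality)
  then show ?thesis
    using Span_mult_closed[OF assms(1) exp_base_closed[OF assms(2)]
        _ eval_in_Span_exp_base[OF assms(1,2) t]] subringE(3,5)[OF assms(1)]
    by simp
qed

end

text \<open>The span of the powers below the degree contains \<open>K\<close> and is stable under
  multiplication by \<open>x\<close>, so it exhausts the simple extension.\<close>

lemma (in domain) simple_extension_of_integral:
  assumes "subring K R" "x \<in> carrier R" "(integral over K) x"
  obtains n where "simple_extension K x = Span K (exp_base x n)"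
proof -
  obtain p where p: "p \<in> carrier (K[X])" "p \<noteq> []" "lead_coeff p = \<one>" "eval p x = \<zero>"
    using assms(3) unfolding over_def integral_def by blast
  have pK: "set p \<subseteq> K" using p(1) polynomial_incl by (simp add: univ_poly_carrier[symmetric])
  define S where "S = Span K (exp_base x (degree p))"
  note B = exp_base_closed[OF assms(2), of "degree p"]
  note zero = Span_zero_closed[OF assms(1) B, folded S_def]
    and add = Span_add_closed[OF assms(1) B, folded S_def]
    and mult = Span_mult_closed[OF assms(1) B, folded S_def]
    and pow = pow_in_Span_exp_base[OF assms(1,2) pK p(2-4), folded S_def]
  note K = subringE[OF assms(1)]
  have "S \<subseteq> {y \<in> carrier R. y \<otimes> x \<in> S}"
    unfolding S_def
  proof (rule Span_least, fold S_def)
    fix k u assume k: "k \<in> K" and "u \<in> set (exp_base x (degree p))"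
    then obtain i where i: "i < degree p" "u = x [^] i" by (auto simp: exp_base_def)
    \<comment> \<open>Here \<open>Suc i\<close> may equal \<open>degree p\<close>, the extra
      exponent that \<open>pow\<close> covers.\<close>
    then have "k \<otimes> x [^] Suc i \<in> S" using k by (intro mult pow) auto
    then show "k \<otimes> u \<in> {y \<in> carrier R. y \<otimes> x \<in> S}"
      using k i(2) K(1) assms(2) by (auto simp: m_assoc subset_iff)
  qed (use assms(2) zero add in \<open>auto simp: l_distr\<close>)
  then have mult_x: "y \<otimes> x \<in> S" if "y \<in> S" for y using that by blast
  \<comment> \<open>Write \<open>k\<close> as \<open>k\<close> times the power with exponent 0;
    \<open>pow\<close> allows this exponent as soon as \<open>p\<close> is nonempty, whatever its
    degree.\<close>
  have K_S: "k \<in> S" if "k \<in> K" for k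
    using mult[OF that pow[of 0]] that K(1) p(2) by auto
  have "simple_extension K x = S"
  proof
    show "simple_extension K x \<subseteq> S"
    proof
      fix y assume "y \<in> simple_extension K x"
      \<comment> \<open>The inductive rules of \<open>simple_extension\<close> follow Horner's
        scheme: start from zero, then multiply by \<open>x\<close> and add an element of
        \<open>K\<close>.\<close>
      then show "y \<in> S"
        by induct (auto intro: zero add mult_x K_S)
    qed
    note E = subringE[OF simple_extension_is_subring[OF assms(1,2)]]
    have "x [^] i \<in> simple_extension K x" for i :: nat
      using E(3,6) simple_extension_mem[OF assms(1,2)] by (induct i) auto
    then show "S \<subseteq> simple_extension K x"
      unfolding S_def using E(2,6,7) simple_extension_incl[OF K(1) assms(2)]
      by (intro Span_least) (auto simp: exp_base_def)
  qed
  then show thesis using that S_def by simp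
qed

section \<open>Adjoining finitely many integral elements\<close>

text \<open>Both sides are the smallest subring containing \<open>H\<close> and \<open>x\<close>.
  This lets generators be adjoined one at a time.\<close>

lemma (in domain) generate_ring_insert:
  assumes "H \<subseteq> carrier R" "x \<in> carrier R"
  shows "generate_ring R (insert x H) = simple_extension (generate_ring R H) x"
proof (rule generate_ringI[symmetric])
  note G = generate_ring_is_subring[OF assms(1)]
  show "insert x H \<subseteq> carrier R" using assms by simp
  show "subring (simple_extension (generate_ring R H) x) R"
    using simple_extension_is_subring[OF G assms(2)] .
  show "insert x H \<subseteq> simple_extension (generate_ring R H) x"
    using simple_extension_mem[OF G assms(2)] generate_ring.incl[of _ H R]
      simple_extension_incl[OF subringE(1)[OF G] assms(2)] by blast
  show "simple_extension (generate_ring R H) x \<subseteq> K"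
    if "subring K R" "insert x H \<subseteq> K" for K
    using that generate_ring_min_subring1[OF assms(1)]
    by (intro simple_extension_subring_incl) auto
qed

lemma (in ring) integral_mono:
  assumes "K \<subseteq> K'" "(integral over K) x"
  shows "(integral over K') x"
proof -
  have "carrier (K[X]) \<subseteq> carrier (K'[X])"
    using assms(1) unfolding univ_poly_def polynomial_def by auto
  then show ?thesis using assms(2) unfolding over_def integral_def by blast
qed

lemma (in domain) generate_ring_of_integrals:
  assumes "subring A R" "finite S" "S \<subseteq> carrier R" "\<And>x. x \<in> S \<Longrightarrow> (integral over A) x"
  shows "\<exists>us. set us \<subseteq> carrier R \<and> Span A us = generate_ring R (A \<union> S)"
  using assms(2-)
proof (induct S)
  case empty
  note A = subringE[OF assms(1)]
  have "Span A [\<one>] = A"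
  proof
    show "Span A [\<one>] \<subseteq> A"
      using A(1,2,7) by (intro Span_least) auto
    show "A \<subseteq> Span A [\<one>]"
      using A(1) Span_superset[OF assms(1), of "[\<one>]"]
        Span_mult_closed[OF assms(1), of "[\<one>]" _ \<one>] by (fastforce simp del: Span_Cons)
  qed
  moreover have "A = generate_ring R A"
    using A(1) assms(1) by (intro generate_ringI) auto
  ultimately show ?case by (intro exI[of _ "[\<one>]"]) simp
next
  case (insert x S)
  then obtain us where us: "set us \<subseteq> carrier R" "Span A us = generate_ring R (A \<union> S)"
    by auto
  have AS: "A \<union> S \<subseteq> carrier R" and x: "x \<in> carrier R"
    using insert.prems subringE(1)[OF assms(1)] by auto
  note G = generate_ring_is_subring[OF AS]
  have "A \<subseteq> generate_ring R (A \<union> S)" by (auto intro: generate_ring.incl)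
  \<comment> \<open>A monic equation over \<open>A\<close> is also one over the larger ring built so
    far, so the one-element case applies with that ring as base.\<close>
  then have "(integral over generate_ring R (A \<union> S)) x"
    using insert.prems(2) by (auto intro: integral_mono[of A])
  then obtain n where
    "simple_extension (generate_ring R (A \<union> S)) x = Span (generate_ring R (A \<union> S)) (exp_base x n)"
    using simple_extension_of_integral[OF G x] by blast
  also have "\<dots> = Span A [u \<otimes> v. u \<leftarrow> us, v \<leftarrow> exp_base x n]"
    using Span_Span[OF assms(1) us(1) exp_base_closed[OF x], unfolded us(2), OF G] .
  finally have "Span A [u \<otimes> v. u \<leftarrow> us, v \<leftarrow> exp_base x n] = generate_ring R (A \<union> insert x S)"
    using generate_ring_insert[OF AS x] by simp
  moreover have "set [u \<otimes> v. u \<leftarrow> us, v \<leftarrow> exp_base x n] \<subseteq> carrier R"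
    using us(1) exp_base_closed[OF x, of n] by auto
  ultimately show ?case by blast
qed

theorem proposition2p6:
  fixes L (structure) and K A :: "'a set"
  assumes "field L"
    and "subdomain A L"
    and "ring.is_quotient_field L K A"
    and "ring.integral_closure L A K = A"
    and "\<forall>x \<in> carrier L. (ring.algebraic L over K) x"
    and "ring.finitely_generated_algebra L A (ring.integral_closure L A (carrier L))"
  shows "ring.finite_module L A (ring.integral_closure L A (carrier L))"
proof -
  interpret field L by fact
  have A: "subring A L"
    using assms(2) subcring.axioms(1) subdomain.axioms(1) by blast
  obtain S where S: "finite S" "S \<subseteq> integral_closure A (carrier L)"
      "generate_ring L (A \<union> S) = integral_closure A (carrier L)"
    using assms(6) unfolding finitely_generated_algebra_def by blast
  then obtain us where us: "set us \<subseteq> carrier L" "Span A us = generate_ring L (A \<union> S)"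
    using generate_ring_of_integrals[OF A, of S] unfolding integral_closure_def by blast
  \<comment> \<open>The spanning list must lie in the integral closure itself; it does, being
    contained in its own span.\<close>
  then show ?thesis
    using Span_superset[OF A us(1)] S(3) unfolding finite_module_def by auto
qed

end
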